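(* Consider the plant $\dot x=Ax+Bu+Ep(q)+E_ww$, $y=Cx+Du+F_ww$, $q=C_qx$, where $p$ is globally Lipschitz continuous and the disturbance satisfies $\|w\|_\infty\le\omega_0$ for an arbitrary given $\omega_0>0$. Suppose there exist $\alpha_0>0$, $\mu>0$, a symmetric $P>0$ in $\mathbb{R}^{2n_x\times2n_x}$ and matrices $K_1,K_2,L_1,L_2$ such that, for the continuous-time closed-loop system formed by the plant, the observer $\dot{\hat x}=A\hat x+Bu+Ep(\hat q+L_1(\hat y-y))+L_2(\hat y-y)$, $\hat y=C\hat x+Du$, $\hat q=C_q\hat x$, and the controller $u=K_1\hat x+K_2p(C_q\hat x)$, the function $V(z)=z^\top Pz$ with $z=(x^\top,(x-\hat x)^\top)^\top$ satisfies $\dot V\le-\alpha_0V+\mu\|w\|^2$ along its trajectories. Now consider the event-triggered implementation: the same observer (driven by the actually applied input $u$), triggering times $t_0=0<t_1<t_2<\cdots$, $\hat x_s(t)=\hat x(t_k)$ for $t\in[t_k,t_{k+1})$, input $u(t)=K_1\hat x_s(t)+K_2p(C_q\hat x_s(t))$, and the triggering rule $t_{k+1}=\inf\{t\mid t\ge t_k+\tau,\ \|\hat x_s(t)-\hat x(t)\|>\sigma\|\hat x(t)\|+\epsilon\}$. Then positive numbers $\tau,\sigma,\epsilon$ can be chosen such that this event-triggered closed-loop system is input-to-state practically stable (ISpS) with respect to $w$.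
   Context: Plant: $x\in\mathbb{R}^{n_x}$ state, $u\in\mathbb{R}^{n_u}$ input, $y\in\mathbb{R}^{n_y}$ output, $w\in\mathbb{R}^{n_w}$ unknown measurable disturbance; $A,B,C,D,C_q,E,E_w,F_w$ constant real matrices of compatible sizes; $p:\mathbb{R}^{n_q}\to\mathbb{R}^{n_p}$ known with $p(0)=0$. The closed loop is ISpS w.r.t. $w$ if there exist $\beta_1\in\mathcal{KL}$, $\beta_2\in\mathcal K$ and a constant $d\ge0$ such that for every initial condition $(x(0),\hat x(0))$ and every admissible disturbance $w$, $\|z(t)\|\le\beta_1(\|z(0)\|,t)+\beta_2(\|w\|_\infty)+d$ for all $t\ge0$, where $z=(x^\top,(x-\hat x)^\top)^\top$ and $\|w\|_\infty=\sup_{t\ge0}\|w(t)\|$. *)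

theory Defs
  imports "HOL-Analysis.Analysis"
begin

text \<open>Stacked vector z = (a, b) in R^(2n), indexed by the sum type 'n + 'n.\<close>
definition stack :: "real^'n \<Rightarrow> real^'n \<Rightarrow> real^('n + 'n)" where
  "stack a b = (\<chi> i. case i of Inl j \<Rightarrow> a $ j | Inr j \<Rightarrow> b $ j)"

text \<open>Plant: xdot = A x + B u + E p(Cq x) + Ew w.\<close>
definition plant_dx ::
  "real^'nx^'nx \<Rightarrow> real^'nu^'nx \<Rightarrow> real^'np^'nx \<Rightarrow> real^'nw^'nx \<Rightarrow> real^'nx^'nq
   \<Rightarrow> (real^'nq \<Rightarrow> real^'np) \<Rightarrow> real^'nx \<Rightarrow> real^'nu \<Rightarrow> real^'nw \<Rightarrow> real^'nx" where
  "plant_dx A B E Ew Cq p x u w = A *v x + B *v u + E *v p (Cq *v x) + Ew *v w"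

text \<open>Plant output: y = C x + D u + Fw w.\<close>
definition plant_y ::
  "real^'nx^'ny \<Rightarrow> real^'nu^'ny \<Rightarrow> real^'nw^'ny \<Rightarrow> real^'nx \<Rightarrow> real^'nu \<Rightarrow> real^'nw \<Rightarrow> real^'ny" where
  "plant_y C D Fw x u w = C *v x + D *v u + Fw *v w"

text \<open>Observer: xhdot = A xh + B u + E p(qh + L1 (yh - y)) + L2 (yh - y), yh = C xh + D u, qh = Cq xh.\<close>
definition obs_dxh ::
  "real^'nx^'nx \<Rightarrow> real^'nu^'nx \<Rightarrow> real^'nx^'ny \<Rightarrow> real^'nu^'ny \<Rightarrow> real^'np^'nx \<Rightarrow> real^'nx^'nq
   \<Rightarrow> real^'ny^'nq \<Rightarrow> real^'ny^'nx \<Rightarrow> (real^'nq \<Rightarrow> real^'np)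
   \<Rightarrow> real^'nx \<Rightarrow> real^'nu \<Rightarrow> real^'ny \<Rightarrow> real^'nx" where
  "obs_dxh A B C D E Cq L1 L2 p xh u y =
     (let yh = C *v xh + D *v u; qh = Cq *v xh
      in A *v xh + B *v u + E *v p (qh + L1 *v (yh - y)) + L2 *v (yh - y))"

text \<open>Controller: u = K1 xh + K2 p(Cq xh).\<close>
definition ctrl ::
  "real^'nx^'nu \<Rightarrow> real^'np^'nu \<Rightarrow> real^'nx^'nq \<Rightarrow> (real^'nq \<Rightarrow> real^'np) \<Rightarrow> real^'nx \<Rightarrow> real^'nu" where
  "ctrl K1 K2 Cq p xh = K1 *v xh + K2 *v p (Cq *v xh)"

text \<open>Dissipation inequality Vdot <= -alpha0 V + mu |w|^2 for V(z) = z' P z along the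
  continuous-time closed loop (plant + observer + controller u = K1 xh + K2 p(Cq xh)),
  stated pointwise for all states and all admissible disturbance values |w| <= omega0.\<close>
definition cl_lyap where
  "cl_lyap A B C D E Ew Fw Cq p K1 K2 L1 L2 (P :: real^('nx + 'nx)^('nx + 'nx)) \<alpha>0 \<mu> \<omega>0 \<longleftrightarrow>
    (\<forall>(x :: real^'nx) (xh :: real^'nx) w. norm w \<le> \<omega>0 \<longrightarrow>
      (let u = ctrl K1 K2 Cq p xh;
           dx = plant_dx A B E Ew Cq p x u w;
           dxh = obs_dxh A B C D E Cq L1 L2 p xh u (plant_y C D Fw x u w);
           z = stack x (x - xh);
           dz = stack dx (dx - dxh)
       in dz \<bullet> (P *v z) + z \<bullet> (P *v dz) \<le> - \<alpha>0 * (z \<bullet> (P *v z)) + \<mu> * (norm w)\<^sup>2))"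

text \<open>Comparison functions.\<close>
definition class_K :: "(real \<Rightarrow> real) \<Rightarrow> bool" where
  "class_K \<gamma> \<longleftrightarrow> continuous_on {0..} \<gamma> \<and> strict_mono_on {0..} \<gamma> \<and> \<gamma> 0 = 0"

definition class_KL :: "(real \<Rightarrow> real \<Rightarrow> real) \<Rightarrow> bool" where
  "class_KL \<beta> \<longleftrightarrow>
     (\<forall>t\<ge>0. class_K (\<lambda>s. \<beta> s t)) \<and>
     (\<forall>s\<ge>0. (\<forall>t1 t2. 0 \<le> t1 \<longrightarrow> t1 \<le> t2 \<longrightarrow> \<beta> s t2 \<le> \<beta> s t1) \<and>
              ((\<lambda>t. \<beta> s t) \<longlongrightarrow> 0) at_top)"

text \<open>Admissible disturbance: Lebesgue measurable on [0,oo) with |w(t)| <= omega0 for t >= 0.\<close>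
definition admissible_dist :: "real \<Rightarrow> (real \<Rightarrow> real^'nw) \<Rightarrow> bool" where
  "admissible_dist \<omega>0 w \<longleftrightarrow> w \<in> borel_measurable (lebesgue_on {0..}) \<and> (\<forall>t\<ge>0. norm (w t) \<le> \<omega>0)"

definition sup_norm :: "(real \<Rightarrow> real^'nw) \<Rightarrow> real" where
  "sup_norm w = (SUP t\<in>{0..}. norm (w t))"

text \<open>Solutions (Caratheodory, integral form, on [0,oo)) of the event-triggered closed loop.
  tk are the triggering times (extended reals; \<infinity> means no further event), xs is the held
  observer state, the input is u = K1 xs + K2 p(Cq xs), and the observer is driven by this u.
  Triggering rule: t_{k+1} = inf {t | t >= t_k + tau, |xh(t_k) - xh(t)| > sigma |xh(t)| + eps},
  where xh(t_k) is the value of xs held since t_k.\<close>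
definition et_solution where
  "et_solution A B C D E Ew Fw Cq p K1 K2 L1 L2 \<tau> \<sigma> \<epsilon> w
      (x :: real \<Rightarrow> real^'nx) (xh :: real \<Rightarrow> real^'nx) (xs :: real \<Rightarrow> real^'nx) (tk :: nat \<Rightarrow> ereal) \<longleftrightarrow>
    tk 0 = 0 \<and>
    (\<forall>k. tk k < \<infinity> \<longrightarrow>
       tk (Suc k) = Inf (ereal ` {t. tk k + ereal \<tau> \<le> ereal t \<and>
                          norm (xh (real_of_ereal (tk k)) - xh t) > \<sigma> * norm (xh t) + \<epsilon>})) \<and>
    (\<forall>k. tk k = \<infinity> \<longrightarrow> tk (Suc k) = \<infinity>) \<and>
    (\<forall>k t. tk k \<le> ereal t \<and> ereal t < tk (Suc k) \<longrightarrow> xs t = xh (real_of_ereal (tk k))) \<and>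
    (\<forall>t\<ge>0. ((\<lambda>s. plant_dx A B E Ew Cq p (x s) (ctrl K1 K2 Cq p (xs s)) (w s))
               has_integral (x t - x 0)) {0..t}) \<and>
    (\<forall>t\<ge>0. ((\<lambda>s. obs_dxh A B C D E Cq L1 L2 p (xh s) (ctrl K1 K2 Cq p (xs s))
                   (plant_y C D Fw (x s) (ctrl K1 K2 Cq p (xs s)) (w s)))
               has_integral (xh t - xh 0)) {0..t})"

text \<open>ISpS of the event-triggered closed loop w.r.t. w, with z = (x, x - xh).\<close>
definition ISpS_et where
  "ISpS_et A B C D E Ew Fw Cq p K1 K2 L1 L2 \<tau> \<sigma> \<epsilon> \<omega>0 \<longleftrightarrow>
    (\<exists>\<beta>1 \<beta>2 d. class_KL \<beta>1 \<and> class_K \<beta>2 \<and> d \<ge> 0 \<and>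
      (\<forall>w (x :: real \<Rightarrow> real^'nx) xh xs tk.
         admissible_dist \<omega>0 w \<and>
         et_solution A B C D E Ew Fw Cq p K1 K2 L1 L2 \<tau> \<sigma> \<epsilon> w x xh xs tk \<longrightarrow>
         (\<forall>t\<ge>0. norm (stack (x t) (x t - xh t))
                  \<le> \<beta>1 (norm (stack (x 0) (x 0 - xh 0))) t + \<beta>2 (sup_norm w) + d)))"

end

theory Submission
  imports Defs
begin

text \<open>Holding the observer state only perturbs the plant input, so along the event-triggered
  loop \<open>V(z) = z' P z\<close> satisfies the continuous-time dissipation inequality up to a term
  proportional to \<open>|xs - xh| |z|\<close>, where \<open>xh\<close> is the observer state and \<open>xs\<close> its held value.
  Events are at least \<open>\<tau>\<close> apart; after the dwell time \<open>\<tau>\<close> the triggering rule keeps the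
  sampling error below \<open>\<sigma> |xh| + \<epsilon>\<close>, and during it the growth bound of the vector fields keeps
  it below \<open>O(\<tau>) (|z| + \<omega>0)\<close>. For \<open>\<sigma>\<close> and \<open>\<tau>\<close> small the relative part of the error
  costs at most half the decay rate, so \<open>dV/dt \<le> -\<alpha>0 V / 2 + c\<close>, and the comparison lemma
  yields an exponential bound on \<open>|z|\<close> plus a constant, i.e. ISpS with \<open>\<epsilon> = \<omega>0\<close>.\<close>

lemma stack_inner: "stack a b \<bullet> stack c d = a \<bullet> c + b \<bullet> d"
proof -
  have "stack a b \<bullet> stack c d = (\<Sum>i\<in>UNIV <+> UNIV. stack a b $ i * stack c d $ i)"
    by (simp add: inner_vec_def UNIV_Plus_UNIV)
  also have "\<dots> = (\<Sum>i\<in>UNIV. a $ i * c $ i) + (\<Sum>i\<in>UNIV. b $ i * d $ i)"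
    by (subst sum.Plus) (auto simp: stack_def o_def)
  finally show ?thesis by (simp add: inner_vec_def)
qed

lemma norm_stack_power2: "(norm (stack a b))\<^sup>2 = (norm a)\<^sup>2 + (norm b)\<^sup>2"
  by (simp add: power2_norm_eq_inner stack_inner)

lemma norm_le_norm_stack1: "norm a \<le> norm (stack a b)"
  by (rule power2_le_imp_le) (simp_all add: norm_stack_power2)

lemma norm_le_norm_stack2: "norm b \<le> norm (stack a b)"
  by (rule power2_le_imp_le) (simp_all add: norm_stack_power2)

lemma norm_stack_le: "norm (stack a b) \<le> norm a + norm b"
proof (rule power2_le_imp_le)
  show "(norm (stack a b))\<^sup>2 \<le> (norm a + norm b)\<^sup>2"
    unfolding norm_stack_power2 power2_sum by simp
qed simp

lemma norm_stack_zero2: "norm (stack a 0) = norm a"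
  using norm_stack_power2[of a 0] by (simp add: power2_eq_iff_nonneg)

lemma norm_stack_zero1: "norm (stack 0 b) = norm b"
  using norm_stack_power2[of 0 b] by (simp add: power2_eq_iff_nonneg)

lemma stack_add: "stack (a + c) (b + d) = stack a b + stack c d"
  by (simp add: stack_def vec_eq_iff split: sum.splits)

lemma stack_diff: "stack (a - c) (b - d) = stack a b - stack c d"
  by (simp add: stack_def vec_eq_iff split: sum.splits)

lemma stack_scaleR: "stack (r *\<^sub>R a) (r *\<^sub>R b) = r *\<^sub>R stack a b"
  by (simp add: stack_def vec_eq_iff split: sum.splits)

lemma stack_split: "stack a b = stack a 0 + stack 0 b"
  using stack_add[of a 0 0 b] by simp

lemma bounded_linear_stack1: "bounded_linear (\<lambda>a. stack a 0)"
proof (rule bounded_linear_intro[where K=1])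
  show "stack (a + b) 0 = stack a 0 + stack b 0" for a b using stack_add[of a b 0 0] by simp
  show "stack (r *\<^sub>R a) 0 = r *\<^sub>R stack a 0" for r a using stack_scaleR[of r a 0] by simp
qed (simp add: norm_stack_zero2)

lemma bounded_linear_stack2: "bounded_linear (\<lambda>b. stack 0 b)"
proof (rule bounded_linear_intro[where K=1])
  show "stack 0 (a + b) = stack 0 a + stack 0 b" for a b using stack_add[of 0 0 a b] by simp
  show "stack 0 (r *\<^sub>R b) = r *\<^sub>R stack 0 b" for r b using stack_scaleR[of r 0 b] by simp
qed (simp add: norm_stack_zero1)

lemma continuous_on_stack:
  assumes "continuous_on S f" "continuous_on S g"
  shows "continuous_on S (\<lambda>r. stack (f r) (g r))"
proof -
  have "continuous_on S (\<lambda>r. stack (f r) 0 + stack 0 (g r))"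
    by (intro continuous_on_add bounded_linear.continuous_on[OF bounded_linear_stack1 assms(1)]
        bounded_linear.continuous_on[OF bounded_linear_stack2 assms(2)])
  then show ?thesis by (simp flip: stack_split)
qed

lemma has_integral_stack:
  assumes "(f has_integral i) S" "(g has_integral j) S"
  shows "((\<lambda>r. stack (f r) (g r)) has_integral stack i j) S"
  using has_integral_add[OF has_integral_linear[OF assms(1) bounded_linear_stack1]
      has_integral_linear[OF assms(2) bounded_linear_stack2]]
  by (simp add: o_def stack_split[symmetric])

lemma norm_le_twice_norm_stack_diff: "norm b \<le> 2 * norm (stack a (a - b))"
proof -
  have "norm b \<le> norm a + norm (a - b)" using norm_triangle_ineq4[of a "a - b"] by simp
  then show ?thesis using norm_le_norm_stack1[of a "a - b"] norm_le_norm_stack2[of "a - b" a] by simp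
qed

lemma norm_stack_diff_le:
  "norm (stack x1 (x1 - h1)) \<le> norm (stack x2 (x2 - h2)) + 2 * norm (x1 - x2) + norm (h1 - h2)"
proof -
  have "stack x1 (x1 - h1) = stack x2 (x2 - h2) + stack (x1 - x2) ((x1 - x2) - (h1 - h2))"
    by (simp add: stack_add[symmetric] algebra_simps)
  then have "norm (stack x1 (x1 - h1)) \<le> norm (stack x2 (x2 - h2)) + norm (stack (x1 - x2) ((x1 - x2) - (h1 - h2)))"
    by (metis norm_triangle_ineq)
  also have "norm (stack (x1 - x2) ((x1 - x2) - (h1 - h2))) \<le> norm (x1 - x2) + norm ((x1 - x2) - (h1 - h2))"
    by (rule norm_stack_le)
  also have "norm ((x1 - x2) - (h1 - h2)) \<le> norm (x1 - x2) + norm (h1 - h2)" by (rule norm_triangle_ineq4)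
  finally show ?thesis by simp
qed

lemma abs_inner_matrix_le:
  assumes "\<And>v. norm (P *v v) \<le> K * norm v"
  shows "\<bar>a \<bullet> (P *v b)\<bar> \<le> K * norm a * norm b"
proof -
  have "\<bar>a \<bullet> (P *v b)\<bar> \<le> norm a * norm (P *v b)" by (rule Cauchy_Schwarz_ineq2)
  also have "\<dots> \<le> norm a * (K * norm b)" by (simp add: assms mult_left_mono)
  finally show ?thesis by (simp add: algebra_simps)
qed

lemma pos_def_quadratic_lower_bound:
  fixes P :: "real^'m^'m"
  assumes "\<forall>z. z \<noteq> 0 \<longrightarrow> z \<bullet> (P *v z) > 0"
  obtains c where "c > 0" "\<And>z. c * (norm z)\<^sup>2 \<le> z \<bullet> (P *v z)"
proof -
  have cont: "continuous_on (sphere 0 1) (\<lambda>z::real^'m. z \<bullet> (P *v z))"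
    by (intro continuous_on_inner continuous_on_id bounded_linear.continuous_on[OF matrix_vector_mul_bounded_linear])
  obtain u :: "real^'m" where u: "norm u = 1" using vector_choose_size[of 1] by auto
  have ne: "sphere (0::real^'m) 1 \<noteq> {}" using u by auto
  obtain z0 where z0: "z0 \<in> sphere 0 1" "\<And>z. z \<in> sphere 0 1 \<Longrightarrow> z0 \<bullet> (P *v z0) \<le> z \<bullet> (P *v z)"
    using continuous_attains_inf[OF compact_sphere ne cont] by blast
  define c where "c = z0 \<bullet> (P *v z0)"
  have "z0 \<noteq> 0" using z0 by auto
  then have cpos: "c > 0" using assms c_def by auto
  show ?thesis
  proof (rule that[OF cpos])
    fix z :: "real^'m"
    show "c * (norm z)\<^sup>2 \<le> z \<bullet> (P *v z)"
    proof (cases "z = 0")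
      case True then show ?thesis by simp
    next
      case False
      define v where "v = (1 / norm z) *\<^sub>R z"
      have "v \<in> sphere 0 1" using False by (simp add: v_def)
      then have "c \<le> v \<bullet> (P *v v)" using z0 c_def by auto
      also have "v \<bullet> (P *v v) = (1 / norm z)^2 * (z \<bullet> (P *v z))"
        by (simp add: v_def matrix_vector_mult_scaleR power2_eq_square)
      finally have "c \<le> (1 / norm z)^2 * (z \<bullet> (P *v z))" .
      then have "c * (norm z)\<^sup>2 \<le> (1 / norm z)^2 * (z \<bullet> (P *v z)) * (norm z)\<^sup>2"
        by (simp add: mult_right_mono)
      also have "\<dots> = z \<bullet> (P *v z)" using False by (simp add: power2_eq_square field_simps)
      finally show ?thesis .
    qed
  qed
qed

lemma le_if_quadratic_increments:
  fixes G :: "real \<Rightarrow> real"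
  assumes st: "s \<le> t" and C0: "C \<ge> 0"
    and step: "\<And>a b. s \<le> a \<Longrightarrow> a \<le> b \<Longrightarrow> b \<le> t \<Longrightarrow> G b - G a \<le> C * (b - a)\<^sup>2"
  shows "G t \<le> G s"
proof (rule ccontr)
  assume "\<not> G t \<le> G s"
  then have dpos: "G t - G s > 0" by simp
  obtain n :: nat where n: "real n > C * (t - s)\<^sup>2 / (G t - G s)" using reals_Archimedean2 by blast
  have npos: "n > 0"
  proof -
    have "C * (t - s)\<^sup>2 / (G t - G s) \<ge> 0" using C0 dpos by simp
    then show ?thesis using n by (cases n) auto
  qed
  define d where "d = (t - s) / real n"
  have d0: "d \<ge> 0" using st npos by (simp add: d_def)
  have ind: "i \<le> n \<Longrightarrow> G (s + real i * d) - G s \<le> real i * C * d\<^sup>2" for i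
  proof (induction i)
    case 0 then show ?case by simp
  next
    case (Suc i)
    have le: "s + real (Suc i) * d \<le> t"
    proof -
      have "real (Suc i) * d \<le> real n * d" using Suc.prems d0 by (intro mult_right_mono) auto
      also have "real n * d = t - s" using npos by (simp add: d_def)
      finally show ?thesis by simp
    qed
    have "G (s + real (Suc i) * d) - G (s + real i * d) \<le> C * ((s + real (Suc i) * d) - (s + real i * d))\<^sup>2"
      using d0 le by (intro step) (auto simp: algebra_simps)
    also have "(s + real (Suc i) * d) - (s + real i * d) = d" by (simp add: algebra_simps)
    finally have "G (s + real (Suc i) * d) - G (s + real i * d) \<le> C * d\<^sup>2" .
    with Suc show ?case by (simp add: algebra_simps)
  qed
  from ind[of n] have "G (s + real n * d) - G s \<le> real n * C * d\<^sup>2" by simp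
  moreover have "s + real n * d = t" using npos by (simp add: d_def)
  moreover have "real n * C * d\<^sup>2 = C * (t - s)\<^sup>2 / real n"
    using npos by (simp add: d_def power2_eq_square field_simps)
  ultimately have "G t - G s \<le> C * (t - s)\<^sup>2 / real n" by simp
  then have "(G t - G s) * real n \<le> C * (t - s)\<^sup>2" using npos by (simp add: field_simps)
  moreover have "C * (t - s)\<^sup>2 < real n * (G t - G s)" using n dpos by (simp add: field_simps)
  ultimately show False by (simp add: mult.commute)
qed

lemma norm_increment_le:
  fixes f :: "real \<Rightarrow> 'a::real_normed_vector"
  assumes "(f has_integral i) {a..b}" and "a \<le> b" and "\<And>r. r \<in> {a..b} \<Longrightarrow> norm (f r) \<le> B"
  shows "norm i \<le> B * (b - a)"
proof -
  have "0 \<le> B" using assms(3)[of a] assms(2) by (meson atLeastAtMost_iff norm_ge_zero order.trans order_refl)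
  then show ?thesis using has_integral_bound_real[where S="{}", OF _ _ assms(1)] assms(2,3) by simp
qed

lemma quadratic_form_increment_le:
  fixes z dz :: "real \<Rightarrow> real^'m" and P :: "real^'m^'m"
  assumes ab: "a \<le> b"
    and int: "\<And>r. r \<in> {a..b} \<Longrightarrow> (dz has_integral (z r - z a)) {a..r}"
    and bnd: "\<And>r. r \<in> {a..b} \<Longrightarrow> norm (dz r) \<le> M"
    and K0: "K \<ge> 0"
    and KP: "\<And>v. norm (P *v v) \<le> K * norm v"
    and lyap: "\<And>r. r \<in> {a..b} \<Longrightarrow> dz r \<bullet> (P *v z r) + z r \<bullet> (P *v dz r) \<le> h r"
    and hint: "h integrable_on {a..b}"
  shows "z b \<bullet> (P *v z b) - z a \<bullet> (P *v z a) \<le> integral {a..b} h + 3 * K * M\<^sup>2 * (b - a)\<^sup>2"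
proof -
  have M0: "M \<ge> 0" using bnd[of a] ab by (meson atLeastAtMost_iff norm_ge_zero order.trans order_refl)
  define \<Delta> where "\<Delta> = z b - z a"
  have dist: "norm (z r - z a) \<le> M * (b - a)" if r: "r \<in> {a..b}" for r
  proof -
    have "norm (z r - z a) \<le> M * (r - a)" using norm_increment_le[OF int[OF r]] bnd r by simp
    also have "\<dots> \<le> M * (b - a)" using r M0 by (intro mult_left_mono) auto
    finally show ?thesis .
  qed
  define L where "L y = y \<bullet> (P *v z a) + z a \<bullet> (P *v y)" for y
  have expand: "z b \<bullet> (P *v z b) - z a \<bullet> (P *v z a) = L \<Delta> + \<Delta> \<bullet> (P *v \<Delta>)"
    by (simp add: L_def \<Delta>_def matrix_vector_mult_diff_distrib inner_diff_left inner_diff_right algebra_simps)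
  have "bounded_linear L"
    unfolding L_def
    by (intro bounded_linear_add bounded_linear_inner_left
        bounded_linear_compose[OF bounded_linear_inner_right matrix_vector_mul_bounded_linear])
  then have L_int: "((\<lambda>r. L (dz r)) has_integral L \<Delta>) {a..b}"
    using has_integral_linear[OF int[of b]] ab by (simp add: o_def \<Delta>_def)
  have L_le: "L (dz r) \<le> h r + 2 * K * M * M * (b - a)" if r: "r \<in> {a..b}" for r
  proof -
    have "L (dz r) = (dz r \<bullet> (P *v z r) + z r \<bullet> (P *v dz r))
        + (dz r \<bullet> (P *v (z a - z r)) + (z a - z r) \<bullet> (P *v dz r))"
      by (simp add: L_def matrix_vector_mult_diff_distrib inner_diff_left inner_diff_right algebra_simps)
    moreover have "\<bar>dz r \<bullet> (P *v (z a - z r))\<bar> \<le> K * M * (M * (b - a))"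
      and "\<bar>(z a - z r) \<bullet> (P *v dz r)\<bar> \<le> K * M * (M * (b - a))"
    proof -
      have "K * (norm (dz r) * norm (z a - z r)) \<le> K * (M * (M * (b - a)))"
        using bnd[OF r] dist[OF r] K0 M0 by (intro mult_left_mono mult_mono) (auto simp: norm_minus_commute)
      then show "\<bar>dz r \<bullet> (P *v (z a - z r))\<bar> \<le> K * M * (M * (b - a))"
        and "\<bar>(z a - z r) \<bullet> (P *v dz r)\<bar> \<le> K * M * (M * (b - a))"
        using abs_inner_matrix_le[OF KP, of "dz r" "z a - z r"] abs_inner_matrix_le[OF KP, of "z a - z r" "dz r"]
        by (simp_all add: algebra_simps)
    qed
    ultimately show ?thesis using lyap[OF r] by (simp add: abs_le_iff)
  qed
  have "((\<lambda>r. h r + 2 * K * M * M * (b - a)) has_integral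
      (integral {a..b} h + 2 * K * M * M * (b - a) * (b - a))) {a..b}"
    using has_integral_add[OF integrable_integral[OF hint] has_integral_const_real[of "2 * K * M * M * (b - a)" a b]] ab
    by (simp add: mult.commute)
  then have "L \<Delta> \<le> integral {a..b} h + 2 * K * M * M * (b - a) * (b - a)"
    by (rule has_integral_le[OF L_int _ L_le])
  moreover have "\<Delta> \<bullet> (P *v \<Delta>) \<le> K * (M * (b - a)) * (M * (b - a))"
  proof -
    have "\<Delta> \<bullet> (P *v \<Delta>) \<le> K * norm \<Delta> * norm \<Delta>" using abs_inner_matrix_le[OF KP, of \<Delta> \<Delta>] by simp
    also have "\<dots> \<le> K * (M * (b - a)) * (M * (b - a))"
      using dist[of b] K0 M0 ab by (intro mult_mono mult_nonneg_nonneg) (auto simp: \<Delta>_def)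
    finally show ?thesis .
  qed
  ultimately show ?thesis using expand by (simp add: power2_eq_square algebra_simps)
qed

text \<open>There is no chain rule for Caratheodory solutions; instead the first-order expansion
  above is summed over ever finer partitions, where the quadratic errors vanish.\<close>
lemma quadratic_form_increment_le_integral:
  fixes z dz :: "real \<Rightarrow> real^'m" and P :: "real^'m^'m"
  assumes st: "s \<le> t"
    and int: "\<And>a b. s \<le> a \<Longrightarrow> a \<le> b \<Longrightarrow> b \<le> t \<Longrightarrow> (dz has_integral (z b - z a)) {a..b}"
    and bnd: "\<And>r. r \<in> {s..t} \<Longrightarrow> norm (dz r) \<le> M"
    and K0: "K \<ge> 0"
    and KP: "\<And>v. norm (P *v v) \<le> K * norm v"
    and lyap: "\<And>r. r \<in> {s..t} \<Longrightarrow> dz r \<bullet> (P *v z r) + z r \<bullet> (P *v dz r) \<le> h r"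
    and hcont: "continuous_on {s..t} h"
  shows "z t \<bullet> (P *v z t) - z s \<bullet> (P *v z s) \<le> integral {s..t} h"
proof -
  define G where "G u = z u \<bullet> (P *v z u) - integral {s..u} h" for u
  have hint: "h integrable_on {a..b}" if "s \<le> a" "b \<le> t" for a b
    using integrable_continuous_real[OF continuous_on_subset[OF hcont]] that by auto
  have "G b - G a \<le> (3 * K * M\<^sup>2) * (b - a)\<^sup>2" if ab: "s \<le> a" "a \<le> b" "b \<le> t" for a b
  proof -
    have "z b \<bullet> (P *v z b) - z a \<bullet> (P *v z a) \<le> integral {a..b} h + 3 * K * M\<^sup>2 * (b - a)\<^sup>2"
      by (rule quadratic_form_increment_le[where dz=dz, OF ab(2) _ _ K0 KP]) (use ab int bnd lyap hint in auto)
    moreover have "integral {s..b} h = integral {s..a} h + integral {a..b} h"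
      using Henstock_Kurzweil_Integration.integral_combine[OF ab(1) ab(2) hint[OF order_refl ab(3)]] by simp
    ultimately show ?thesis by (simp add: G_def)
  qed
  moreover have "M \<ge> 0" using bnd[of s] st by (meson atLeastAtMost_iff norm_ge_zero order.trans order_refl)
  ultimately have "G t \<le> G s" using le_if_quadratic_increments[OF st, of "3 * K * M\<^sup>2" G] K0 by simp
  then show ?thesis by (simp add: G_def)
qed

text \<open>If \<open>D t > 0\<close>, then \<open>D \<ge> 0\<close> between its last zero \<open>t1\<close> before \<open>t\<close> and \<open>t\<close>, so the
  hypothesis gives \<open>D t \<le> D t1 = 0\<close>.\<close>
lemma nonpos_if_integral_decay:
  fixes D :: "real \<Rightarrow> real"
  assumes a0: "a \<ge> 0" and Dc: "continuous_on {0..t} D" and D0: "D 0 \<le> 0" and t0: "t \<ge> 0"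
    and Dineq: "\<And>s. 0 \<le> s \<Longrightarrow> s \<le> t \<Longrightarrow> D t - D s \<le> - a * integral {s..t} D"
  shows "D t \<le> 0"
proof (rule ccontr)
  assume "\<not> D t \<le> 0"
  then have Dt: "D t > 0" by simp
  define S where "S = {r \<in> {0..t}. D r \<le> 0}"
  have "closed S" unfolding S_def
    by (rule continuous_on_closed_Collect_le[OF Dc continuous_on_const]) simp
  then have "compact ({0..t} \<inter> S)" by (rule compact_Int_closed[OF compact_Icc])
  moreover have "{0..t} \<inter> S = S" by (auto simp: S_def)
  ultimately have "compact S" by simp
  moreover have "S \<noteq> {}" using D0 t0 by (auto simp: S_def)
  ultimately obtain t1 where t1: "t1 \<in> S" "\<And>r. r \<in> S \<Longrightarrow> r \<le> t1"
    using continuous_attains_sup[OF _ _ continuous_on_id, of S] by auto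
  have t1t: "0 \<le> t1" "t1 \<le> t" "D t1 \<le> 0" using t1 by (auto simp: S_def)
  have "\<exists>x\<ge>t1. x \<le> t \<and> D x = 0"
    by (rule IVT'[of D t1 0 t, OF t1t(3) _ t1t(2) continuous_on_subset[OF Dc]]) (use Dt t1t in auto)
  then obtain r0 where "t1 \<le> r0" "r0 \<le> t" "D r0 = 0" by blast
  then have Dt1: "D t1 = 0" using t1(2)[of r0] t1t by (simp add: S_def)
  have "D r \<ge> 0" if "r \<in> {t1..t}" for r
  proof (rule ccontr)
    assume "\<not> D r \<ge> 0"
    then have "r \<in> S" using that t1t by (simp add: S_def)
    then show False using t1(2)[of r] that Dt1 \<open>\<not> D r \<ge> 0\<close> by simp
  qed
  then have "integral {t1..t} D \<ge> 0"
    using integral_nonneg[OF integrable_continuous_real[OF continuous_on_subset[OF Dc]]] t1t by auto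
  then have "D t - D t1 \<le> 0" using Dineq[OF t1t(1) t1t(2)] a0
    using mult_nonneg_nonneg[of a "integral {t1..t} D"] by linarith
  then show False using Dt Dt1 by simp
qed

lemma linear_comparison:
  fixes V :: "real \<Rightarrow> real"
  assumes a0: "a > 0" and c0: "c \<ge> 0"
    and Vc: "\<And>T. continuous_on {0..T} V"
    and ineq: "\<And>s t. 0 \<le> s \<Longrightarrow> s \<le> t \<Longrightarrow> V t - V s \<le> integral {s..t} (\<lambda>r. - a * V r + c)"
    and t0: "t \<ge> 0"
  shows "V t \<le> exp (- a * t) * V 0 + c / a"
proof -
  define y where "y r = exp (- a * r) * (V 0 - c / a) + c / a" for r
  define D where "D r = V r - y r" for r
  have yder: "(y has_vector_derivative (- a * y r + c)) (at r within X)" for r X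
  proof -
    have "(y has_real_derivative (exp (- a * r) * (- a) * (V 0 - c / a))) (at r within X)"
      unfolding y_def by (auto intro!: derivative_eq_intros)
    moreover have "exp (- a * r) * (- a) * (V 0 - c / a) = - a * y r + c"
      using a0 by (simp add: y_def field_simps)
    ultimately show ?thesis by (simp add: has_real_derivative_iff_has_vector_derivative)
  qed
  have "continuous_on X y" for X unfolding y_def by (intro continuous_intros)
  then have Dc: "continuous_on {0..T} D" for T unfolding D_def by (intro continuous_on_diff Vc)
  have Dineq: "D t - D s \<le> - a * integral {s..t} D" if st: "0 \<le> s" "s \<le> t" for s
  proof -
    have yint: "((\<lambda>r. - a * y r + c) has_integral (y t - y s)) {s..t}"
      by (rule fundamental_theorem_of_calculus[OF st(2)]) (rule yder)
    have Vint: "(\<lambda>r. - a * V r + c) integrable_on {s..t}"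
      by (rule integrable_continuous_real, intro continuous_intros continuous_on_subset[OF Vc[of t]]) (use st in auto)
    have "integral {s..t} (\<lambda>r. - a * V r + c) - (y t - y s) = integral {s..t} (\<lambda>r. (- a * V r + c) - (- a * y r + c))"
      using integral_diff[OF Vint has_integral_integrable[OF yint]] integral_unique[OF yint] by simp
    also have "\<dots> = integral {s..t} (\<lambda>r. - a * D r)" by (simp add: D_def algebra_simps)
    also have "\<dots> = - a * integral {s..t} D" by (simp add: integral_mult_right)
    finally show ?thesis using ineq[OF st] by (simp add: D_def)
  qed
  have "D t \<le> 0"
    by (rule nonpos_if_integral_decay[OF _ Dc _ t0 Dineq]) (use a0 in \<open>simp_all add: D_def y_def\<close>)
  moreover have "exp (- a * t) * (- c / a) \<le> 0" using a0 c0 by (simp add: mult_nonneg_nonneg divide_nonneg_pos)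
  ultimately show ?thesis by (simp add: D_def y_def algebra_simps)
qed

lemma event_times_lower_bound:
  fixes tk :: "nat \<Rightarrow> ereal"
  assumes t00: "tk 0 = 0"
    and trig: "\<forall>k. tk k < \<infinity> \<longrightarrow> tk (Suc k) = Inf (ereal ` {t. tk k + ereal \<tau> \<le> ereal t \<and> \<Phi> k t})"
    and inf: "\<forall>k. tk k = \<infinity> \<longrightarrow> tk (Suc k) = \<infinity>"
  shows "ereal (real k * \<tau>) \<le> tk k"
proof (induction k)
  case 0 then show ?case using t00 by (simp add: zero_ereal_def)
next
  case (Suc k)
  show ?case
  proof (cases "tk k = \<infinity>")
    case True then show ?thesis using inf by simp
  next
    case False
    then have fin: "tk k < \<infinity>" by (cases "tk k") auto
    have "ereal (real (Suc k) * \<tau>) = ereal (real k * \<tau>) + ereal \<tau>" by (simp add: algebra_simps)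
    also have "\<dots> \<le> tk k + ereal \<tau>" by (rule add_right_mono[OF Suc.IH])
    also have "\<dots> \<le> Inf (ereal ` {t. tk k + ereal \<tau> \<le> ereal t \<and> \<Phi> k t})" by (rule Inf_greatest) auto
    finally show ?thesis using trig fin by simp
  qed
qed

text \<open>Events are at least \<open>\<tau>\<close> apart, so only finitely many occur before \<open>t\<close>.\<close>
lemma event_interval_around:
  fixes tk :: "nat \<Rightarrow> ereal"
  assumes t00: "tk 0 = 0"
    and trig: "\<forall>k. tk k < \<infinity> \<longrightarrow> tk (Suc k) = Inf (ereal ` {t. tk k + ereal \<tau> \<le> ereal t \<and> \<Phi> k t})"
    and inf: "\<forall>k. tk k = \<infinity> \<longrightarrow> tk (Suc k) = \<infinity>"
    and tau: "\<tau> > 0" and t0: "t \<ge> 0"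
  obtains k c where "tk k = ereal c" "0 \<le> c" "c \<le> t" "ereal t < tk (Suc k)" "c + \<tau> \<le> t \<Longrightarrow> \<not> \<Phi> k t"
proof -
  note lower = event_times_lower_bound[OF t00 trig inf]
  define K where "K = {k. tk k \<le> ereal t}"
  have "K \<subseteq> {..nat (ceiling (t / \<tau>))}"
  proof
    fix k assume "k \<in> K"
    then have "real k * \<tau> \<le> t" using lower[of k] unfolding K_def by (metis ereal_less_eq(3) mem_Collect_eq order.trans)
    then have "real k \<le> t / \<tau>" using tau by (simp add: field_simps)
    then have "real k \<le> real (nat (ceiling (t / \<tau>)))" by linarith
    then show "k \<in> {..nat (ceiling (t / \<tau>))}" by simp
  qed
  then have finK: "finite K" using finite_subset by blast
  have "0 \<in> K" using t00 t0 by (simp add: K_def zero_ereal_def)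
  define k where "k = Max K"
  have kK: "k \<in> K" unfolding k_def using Max_in[OF finK] \<open>0 \<in> K\<close> by blast
  have "Suc k \<notin> K" using Max_ge[OF finK, of "Suc k"] by (auto simp: k_def)
  then have lt: "ereal t < tk (Suc k)" by (simp add: K_def not_le)
  have le: "tk k \<le> ereal t" using kK by (simp add: K_def)
  have ge0: "0 \<le> tk k" using lower[of k] tau by (metis ereal_less_eq(5) mult_nonneg_nonneg of_nat_0_le_iff order_less_imp_le order_trans)
  obtain c where c: "tk k = ereal c" using le ge0 by (cases "tk k") auto
  have "\<not> \<Phi> k t" if ct: "c + \<tau> \<le> t"
  proof
    assume "\<Phi> k t"
    then have "ereal t \<in> ereal ` {t. tk k + ereal \<tau> \<le> ereal t \<and> \<Phi> k t}" using ct c by auto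
    then have "tk (Suc k) \<le> ereal t" using trig c by (metis Inf_lower PInfty_neq_ereal(1) less_ereal.simps(4))
    then show False using lt by simp
  qed
  then show thesis using that c le ge0 lt by auto
qed

lemma exp_neg_linear_tendsto_0:
  fixes a :: real
  assumes "a > 0"
  shows "((\<lambda>t. exp (- (a * t))) \<longlongrightarrow> 0) at_top"
proof -
  have "filterlim (\<lambda>t. a * t) at_top at_top"
    by (intro filterlim_tendsto_pos_mult_at_top[where c=a] tendsto_const filterlim_ident assms)
  then have "filterlim (\<lambda>t. - (a * t)) at_bot at_top" by (simp add: filterlim_uminus_at_bot)
  then show ?thesis by (rule filterlim_compose[OF exp_at_bot])
qed

lemma class_K_id: "class_K (\<lambda>s. s)"
  unfolding class_K_def by (auto simp: strict_mono_on_def intro: continuous_intros)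

lemma class_KL_exp_decay:
  assumes K: "K > 0" and a: "a > 0"
  shows "class_KL (\<lambda>s t. K * s * exp (- (a * t)))"
proof -
  have 1: "class_K (\<lambda>s. K * s * exp (- (a * t)))" for t
    unfolding class_K_def using K by (auto simp: strict_mono_on_def intro!: continuous_intros)
  have 2: "K * s * exp (- (a * t2)) \<le> K * s * exp (- (a * t1))" if "s \<ge> 0" "t1 \<le> t2" for s t1 t2
    using K that a by (auto intro!: mult_left_mono mult_nonneg_nonneg)
  have 3: "((\<lambda>t. K * s * exp (- (a * t))) \<longlongrightarrow> 0) at_top" for s
    using tendsto_mult_right_zero[OF exp_neg_linear_tendsto_0[OF a], of "K * s"] by simp
  show ?thesis unfolding class_KL_def using 1 2 3 by blast
qed

lemma has_integral_increment_subinterval: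
  fixes f X :: "real \<Rightarrow> 'b::euclidean_space" and a b :: real
  assumes "\<forall>t\<ge>0. (f has_integral (X t - X 0)) {0..t}" "0 \<le> a" "a \<le> b"
  shows "(f has_integral (X b - X a)) {a..b}"
proof -
  have b0: "0 \<le> b" using assms by linarith
  have ib: "(f has_integral (X b - X 0)) {0..b}" using assms(1) b0 by blast
  have ia: "(f has_integral (X a - X 0)) {0..a}" using assms(1) assms(2) by blast
  have "f integrable_on {a..b}"
    by (rule integrable_subinterval_real[OF has_integral_integrable[OF ib]]) (use assms in auto)
  then have j: "(f has_integral integral {a..b} f) {a..b}" by auto
  have "(f has_integral (X a - X 0) + integral {a..b} f) {0..b}"
    by (rule has_integral_combine[OF assms(2) assms(3) ia j])
  then have "(X a - X 0) + integral {a..b} f = X b - X 0" using ib by (rule has_integral_unique)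
  then have "integral {a..b} f = X b - X a" by (simp add: algebra_simps)
  then show ?thesis using j by simp
qed

lemma continuous_on_if_integral_form:
  fixes f X :: "real \<Rightarrow> 'b::euclidean_space" and T :: real
  assumes "\<forall>t\<ge>0. (f has_integral (X t - X 0)) {0..t}"
  shows "continuous_on {0..T} X"
proof (cases "T \<ge> 0")
  case True
  have "f integrable_on {0..T}" using assms True by auto
  then have c: "continuous_on {0..T} (\<lambda>t. X 0 + integral {0..t} f)"
    by (rule continuous_on_add[OF continuous_on_const indefinite_integral_continuous_1])
  show ?thesis
  proof (rule continuous_on_eq[OF c])
    fix t assume "t \<in> {0..T}"
    then have "(f has_integral (X t - X 0)) {0..t}" using assms by auto
    then show "X 0 + integral {0..t} f = X t" by (simp add: integral_unique)
  qed
next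
  case False then show ?thesis by simp
qed

lemma norm_add4_le:
  fixes a b c d :: "'a::real_normed_vector"
  shows "norm (a + b + c + d) \<le> norm a + norm b + norm c + norm d"
proof -
  have "norm (a + b + c + d) \<le> norm (a + b + c) + norm d" by (rule norm_triangle_ineq)
  also have "norm (a + b + c) \<le> norm (a + b) + norm c" by (rule norm_triangle_ineq)
  also have "norm (a + b) \<le> norm a + norm b" by (rule norm_triangle_ineq)
  finally show ?thesis by simp
qed

lemma ge_1_products_mono:
  fixes N :: real
  assumes "N \<ge> 1"
  shows "N \<le> N*N*N*N" "N*N \<le> N*N*N*N" "N*N*N \<le> N*N*N*N" "N \<le> N*N*N" "0 \<le> N" "N \<le> N*N"
proof -
  have a: "N \<le> N*N" using assms mult_left_mono[of 1 N N] by simp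
  have b: "N*N \<le> N*N*N" using assms mult_left_mono[of 1 N "N*N"] by simp
  have c: "N*N*N \<le> N*N*N*N" using assms mult_left_mono[of 1 N "N*N*N"] by simp
  show "N \<le> N*N*N*N" "N*N \<le> N*N*N*N" "N*N*N \<le> N*N*N*N" "N \<le> N*N*N" "0 \<le> N" "N \<le> N*N"
    using a b c assms by linarith+
qed

locale plant_bounds =
  fixes A :: "real^'nx^'nx" and B :: "real^'nu^'nx" and C :: "real^'nx^'ny"
    and D :: "real^'nu^'ny" and E :: "real^'np^'nx" and Ew :: "real^'nw^'nx"
    and Fw :: "real^'nw^'ny" and Cq :: "real^'nx^'nq" and p :: "real^'nq \<Rightarrow> real^'np"
    and K1 :: "real^'nx^'nu" and K2 :: "real^'np^'nu"
    and L1 :: "real^'ny^'nq" and L2 :: "real^'ny^'nx" and N :: real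
  assumes N1: "N \<ge> 1"
    and bA: "\<And>v. norm (A *v v) \<le> N * norm v"
    and bB: "\<And>v. norm (B *v v) \<le> N * norm v"
    and bC: "\<And>v. norm (C *v v) \<le> N * norm v"
    and bE: "\<And>v. norm (E *v v) \<le> N * norm v"
    and bEw: "\<And>v. norm (Ew *v v) \<le> N * norm v"
    and bFw: "\<And>v. norm (Fw *v v) \<le> N * norm v"
    and bCq: "\<And>v. norm (Cq *v v) \<le> N * norm v"
    and bK1: "\<And>v. norm (K1 *v v) \<le> N * norm v"
    and bK2: "\<And>v. norm (K2 *v v) \<le> N * norm v"
    and bL1: "\<And>v. norm (L1 *v v) \<le> N * norm v"
    and bL2: "\<And>v. norm (L2 *v v) \<le> N * norm v"
    and bp: "\<And>a b. norm (p a - p b) \<le> N * norm (a - b)"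
    and p0: "p 0 = 0"
begin

lemma norm_p_le: "norm (p a) \<le> N * norm a"
  using bp[of a 0] p0 by simp

lemma norm_ctrl_diff_le: "norm (ctrl K1 K2 Cq p a - ctrl K1 K2 Cq p b) \<le> 2 * (N*N*N) * norm (a - b)"
proof -
  have eq: "ctrl K1 K2 Cq p a - ctrl K1 K2 Cq p b = K1 *v (a - b) + K2 *v (p (Cq *v a) - p (Cq *v b))"
    by (simp add: ctrl_def matrix_vector_mult_diff_distrib algebra_simps)
  have "norm (K2 *v (p (Cq *v a) - p (Cq *v b))) \<le> N * norm (p (Cq *v a) - p (Cq *v b))" by (rule bK2)
  also have "\<dots> \<le> N * (N * norm (Cq *v a - Cq *v b))" using N1 bp by (intro mult_left_mono) auto
  also have "Cq *v a - Cq *v b = Cq *v (a - b)" by (simp add: matrix_vector_mult_diff_distrib)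
  also have "N * (N * norm (Cq *v (a - b))) \<le> N * (N * (N * norm (a - b)))"
    using N1 bCq by (intro mult_left_mono) auto
  finally have 2: "norm (K2 *v (p (Cq *v a) - p (Cq *v b))) \<le> N*N*N * norm (a - b)" by (simp add: mult.assoc)
  have "norm (ctrl K1 K2 Cq p a - ctrl K1 K2 Cq p b) \<le> N * norm (a - b) + N*N*N * norm (a - b)"
    unfolding eq using norm_triangle_ineq[of "K1 *v (a - b)" "K2 *v (p (Cq *v a) - p (Cq *v b))"] bK1[of "a - b"] 2 by linarith
  also have "\<dots> \<le> 2 * (N*N*N) * norm (a - b)"
  proof -
    have "N * norm (a - b) \<le> N*N*N * norm (a - b)" using ge_1_products_mono[OF N1] by (intro mult_right_mono) auto
    moreover have "2 * (N*N*N) * norm (a - b) = N*N*N * norm (a - b) + N*N*N * norm (a - b)" by simp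
    ultimately show ?thesis by linarith
  qed
  finally show ?thesis .
qed

lemma norm_ctrl_le: "norm (ctrl K1 K2 Cq p a) \<le> 2 * (N*N*N) * norm a"
proof -
  have "ctrl K1 K2 Cq p 0 = 0" by (simp add: ctrl_def p0)
  then show ?thesis using norm_ctrl_diff_le[of a 0] by simp
qed

definition plant_field where
  "plant_field x xs w = plant_dx A B E Ew Cq p x (ctrl K1 K2 Cq p xs) w"

definition obs_field where
  "obs_field x xh xs w =
     obs_dxh A B C D E Cq L1 L2 p xh (ctrl K1 K2 Cq p xs) (plant_y C D Fw x (ctrl K1 K2 Cq p xs) w)"

definition vf_bound where "vf_bound = 4 * (N*N*N*N)"

lemma vf_bound_ge_1: "vf_bound \<ge> 1"
  using ge_1_products_mono[OF N1] N1 unfolding vf_bound_def by linarith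

lemma norm_plant_field_le:
  "norm (plant_field x xs w) \<le> vf_bound * (norm x + norm xh + norm xs + norm w)"
proof -
  let ?u = "ctrl K1 K2 Cq p xs"
  have "norm (plant_field x xs w) \<le> norm (A *v x) + norm (B *v ?u) + norm (E *v p (Cq *v x)) + norm (Ew *v w)"
    unfolding plant_field_def plant_dx_def by (rule norm_add4_le)
  moreover have "norm (B *v ?u) \<le> N * (2 * (N*N*N) * norm xs)"
    using bB[of ?u] norm_ctrl_le[of xs] N1 by (meson order_trans mult_left_mono ge_1_products_mono(5)[OF N1])
  moreover have "norm (E *v p (Cq *v x)) \<le> N * (N * (N * norm x))"
  proof -
    have "norm (E *v p (Cq *v x)) \<le> N * norm (p (Cq *v x))" by (rule bE)
    also have "\<dots> \<le> N * (N * norm (Cq *v x))" using norm_p_le N1 by (intro mult_left_mono) auto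
    also have "\<dots> \<le> N * (N * (N * norm x))" using bCq N1 by (intro mult_left_mono) auto
    finally show ?thesis .
  qed
  moreover note bA[of x] bEw[of w]
  moreover have "N * norm x \<le> N*N*N*N * norm x" "N*N*N * norm x \<le> N*N*N*N * norm x" "N * norm w \<le> N*N*N*N * norm w"
    using ge_1_products_mono[OF N1] by (auto intro: mult_right_mono)
  moreover have "0 \<le> N*N*N*N * norm xh" using ge_1_products_mono[OF N1] by simp
  moreover have "N * (2 * (N*N*N) * norm xs) = 2 * (N*N*N*N * norm xs)" "N * (N * (N * norm x)) = N*N*N * norm x"
    by (simp_all add: algebra_simps)
  moreover have "vf_bound * (norm x + norm xh + norm xs + norm w) = 4 * (N*N*N*N * norm x) + 4 * (N*N*N*N * norm xh) + 4 * (N*N*N*N * norm xs) + 4 * (N*N*N*N * norm w)"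
    by (simp add: vf_bound_def algebra_simps)
  moreover have "0 \<le> N*N*N*N * norm x" "0 \<le> N*N*N*N * norm w" "0 \<le> N*N*N*N * norm xs" using ge_1_products_mono[OF N1] by auto
  ultimately show ?thesis by linarith
qed

lemma norm_obs_field_le:
  "norm (obs_field x xh xs w) \<le> vf_bound * (norm x + norm xh + norm xs + norm w)"
proof -
  let ?u = "ctrl K1 K2 Cq p xs"
  define d where "d = C *v xh - C *v x - Fw *v w"
  have obs_eq: "obs_field x xh xs w = A *v xh + B *v ?u + E *v p (Cq *v xh + L1 *v d) + L2 *v d"
    by (simp add: obs_field_def obs_dxh_def plant_y_def d_def Let_def algebra_simps)
  have nd: "norm d \<le> N * norm xh + N * norm x + N * norm w"
  proof -
    have "norm d \<le> norm (C *v xh) + norm (C *v x) + norm (Fw *v w)"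
      unfolding d_def by (metis (no_types, opaque_lifting) add_mono norm_triangle_ineq4 order.trans diff_conv_add_uminus norm_minus_cancel order_refl norm_triangle_ineq)
    then show ?thesis using bC[of xh] bC[of x] bFw[of w] by linarith
  qed
  have t: "norm (obs_field x xh xs w) \<le> norm (A *v xh) + norm (B *v ?u) + norm (E *v p (Cq *v xh + L1 *v d)) + norm (L2 *v d)"
    unfolding obs_eq by (rule norm_add4_le)
  have bu: "norm (B *v ?u) \<le> N * (2 * (N*N*N) * norm xs)"
    using bB[of ?u] norm_ctrl_le[of xs] N1 by (meson order_trans mult_left_mono ge_1_products_mono(5)[OF N1])
  have be: "norm (E *v p (Cq *v xh + L1 *v d)) \<le> N * (N * (N * norm xh + N * norm d))"
  proof -
    have "norm (E *v p (Cq *v xh + L1 *v d)) \<le> N * norm (p (Cq *v xh + L1 *v d))" by (rule bE)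
    also have "\<dots> \<le> N * (N * norm (Cq *v xh + L1 *v d))" using norm_p_le N1 by (intro mult_left_mono) auto
    also have "norm (Cq *v xh + L1 *v d) \<le> N * norm xh + N * norm d"
      using norm_triangle_ineq[of "Cq *v xh" "L1 *v d"] bCq[of xh] bL1[of d] by linarith
    then have "N * (N * norm (Cq *v xh + L1 *v d)) \<le> N * (N * (N * norm xh + N * norm d))"
      using N1 by (intro mult_left_mono) auto
    finally show ?thesis .
  qed
  have bl2: "norm (L2 *v d) \<le> N * norm d" by (rule bL2)
  have P: "N \<le> N*N*N*N" "N*N \<le> N*N*N*N" "N*N*N \<le> N*N*N*N" "0 \<le> N" using ge_1_products_mono[OF N1] by auto
  have nx: "0 \<le> norm x" "0 \<le> norm xh" "0 \<le> norm xs" "0 \<le> norm w" by auto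
  have e1: "N * (N * (N * norm xh + N * norm d)) \<le> N*N*N * norm xh + N*N*N*N*(norm xh + norm x + norm w)"
  proof -
    have "N * (N * (N * norm d)) \<le> N * (N * (N * (N * norm xh + N * norm x + N * norm w)))"
      using nd P(4) by (intro mult_left_mono) auto
    then show ?thesis by (simp add: algebra_simps)
  qed
  have l2: "N * norm d \<le> N * N * (norm xh + norm x + norm w)"
    using mult_left_mono[OF nd P(4)] by (simp add: algebra_simps)
  have sc: "N * norm xh \<le> N*N*N*N * norm xh" "N*N*N * norm xh \<le> N*N*N*N * norm xh"
     "N * N * (norm xh + norm x + norm w) \<le> N*N*N*N * (norm xh + norm x + norm w)"
    using P nx by (auto intro: mult_right_mono)
  have "0 \<le> N*N*N*N * norm x" "0 \<le> N*N*N*N * norm w" "0 \<le> N*N*N*N * norm xh" "0 \<le> N*N*N*N * norm xs" using P nx by auto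
  moreover have "N * (2 * (N*N*N) * norm xs) = 2 * (N*N*N*N * norm xs)" by (simp add: algebra_simps)
  moreover have "N*N*N*N * (norm xh + norm x + norm w) = N*N*N*N * norm xh + N*N*N*N * norm x + N*N*N*N * norm w"
    by (simp add: algebra_simps)
  moreover have "vf_bound * (norm x + norm xh + norm xs + norm w) = 4 * (N*N*N*N * norm x) + 4 * (N*N*N*N * norm xh) + 4 * (N*N*N*N * norm xs) + 4 * (N*N*N*N * norm w)"
    by (simp add: vf_bound_def algebra_simps)
  ultimately show ?thesis using t bu be e1 bA[of xh] bl2 l2 sc by linarith
qed

text \<open>Holding the observer state perturbs only the plant input: the estimation error
  dynamics is unchanged because the observer is driven by the same input.\<close>
lemma lyap_derivative_sampled_le:
  fixes P :: "real^('nx + 'nx)^('nx + 'nx)"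
  assumes lyap: "cl_lyap A B C D E Ew Fw Cq p K1 K2 L1 L2 P \<alpha>0 \<mu> \<omega>0"
    and KPb: "\<And>v. norm (P *v v) \<le> KP * norm v" and KP0: "KP \<ge> 0"
    and w: "norm w \<le> \<omega>0"
  shows "stack (plant_field x xs w) (plant_field x xs w - obs_field x xh xs w) \<bullet> (P *v stack x (x - xh))
       + stack x (x - xh) \<bullet> (P *v stack (plant_field x xs w) (plant_field x xs w - obs_field x xh xs w))
     \<le> - \<alpha>0 * (stack x (x - xh) \<bullet> (P *v stack x (x - xh))) + \<mu> * (norm w)\<^sup>2
       + KP * vf_bound * norm (xs - xh) * norm (stack x (x - xh))"
proof -
  define z where "z = stack x (x - xh)"
  define f0 where "f0 = plant_dx A B E Ew Cq p x (ctrl K1 K2 Cq p xh) w"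
  define g0 where "g0 = obs_dxh A B C D E Cq L1 L2 p xh (ctrl K1 K2 Cq p xh) (plant_y C D Fw x (ctrl K1 K2 Cq p xh) w)"
  define dz0 where "dz0 = stack f0 (f0 - g0)"
  define bd where "bd = B *v (ctrl K1 K2 Cq p xs - ctrl K1 K2 Cq p xh)"
  have L0: "dz0 \<bullet> (P *v z) + z \<bullet> (P *v dz0) \<le> - \<alpha>0 * (z \<bullet> (P *v z)) + \<mu> * (norm w)\<^sup>2"
    using lyap w unfolding cl_lyap_def Let_def z_def dz0_def f0_def g0_def by blast
  have e1: "plant_field x xs w = f0 + bd"
    by (simp add: plant_field_def f0_def bd_def plant_dx_def matrix_vector_mult_diff_distrib algebra_simps)
  have e2: "plant_field x xs w - obs_field x xh xs w = f0 - g0"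
    by (simp add: plant_field_def obs_field_def f0_def g0_def plant_dx_def obs_dxh_def plant_y_def Let_def algebra_simps)
  have dz: "stack (plant_field x xs w) (plant_field x xs w - obs_field x xh xs w) = dz0 + stack bd 0"
    unfolding e2 unfolding e1 dz0_def using stack_add[of f0 bd "f0 - g0" 0] by simp
  have nbd: "norm bd \<le> 2 * (N*N*N*N) * norm (xs - xh)"
  proof -
    have "norm bd \<le> N * norm (ctrl K1 K2 Cq p xs - ctrl K1 K2 Cq p xh)" unfolding bd_def by (rule bB)
    also have "\<dots> \<le> N * (2 * (N*N*N) * norm (xs - xh))" using norm_ctrl_diff_le N1 by (intro mult_left_mono) auto
    finally show ?thesis by (simp add: algebra_simps)
  qed
  have q1: "stack bd 0 \<bullet> (P *v z) \<le> KP * norm bd * norm z"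
    using abs_inner_matrix_le[OF KPb, of "stack bd 0" z] by (simp add: norm_stack_zero2)
  have q2: "z \<bullet> (P *v stack bd 0) \<le> KP * norm bd * norm z"
    using abs_inner_matrix_le[OF KPb, of z "stack bd 0"] by (simp add: norm_stack_zero2 algebra_simps)
  have q3: "KP * norm bd * norm z \<le> KP * (2 * (N*N*N*N) * norm (xs - xh)) * norm z"
    using nbd KP0 by (intro mult_right_mono mult_left_mono) auto
  have "stack (plant_field x xs w) (plant_field x xs w - obs_field x xh xs w) \<bullet> (P *v z) + z \<bullet> (P *v stack (plant_field x xs w) (plant_field x xs w - obs_field x xh xs w))
      = (dz0 \<bullet> (P *v z) + z \<bullet> (P *v dz0)) + (stack bd 0 \<bullet> (P *v z) + z \<bullet> (P *v stack bd 0))"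
    unfolding dz by (simp add: inner_add_left inner_add_right matrix_vector_right_distrib)
  also have "\<dots> \<le> - \<alpha>0 * (z \<bullet> (P *v z)) + \<mu> * (norm w)\<^sup>2 + 2 * (KP * (2 * (N*N*N*N) * norm (xs - xh)) * norm z)"
    using L0 q1 q2 q3 by linarith
  finally show ?thesis unfolding z_def by (simp add: vf_bound_def algebra_simps)
qed

lemma norm_plant_field_le_bound:
  "norm w \<le> \<omega>0 \<Longrightarrow> norm (plant_field x xs w) \<le> vf_bound * (norm x + norm xh + norm xs + \<omega>0)"
  using norm_plant_field_le[of x xs w xh] vf_bound_ge_1
  by (meson add_left_mono dual_order.trans mult_left_mono zero_le_one order_trans)

lemma norm_obs_field_le_bound:
  "norm w \<le> \<omega>0 \<Longrightarrow> norm (obs_field x xh xs w) \<le> vf_bound * (norm x + norm xh + norm xs + \<omega>0)"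
  using norm_obs_field_le[of x xh xs w] vf_bound_ge_1
  by (meson add_left_mono dual_order.trans mult_left_mono zero_le_one order_trans)

end

lemma dwell_window_arith:
  fixes \<theta> \<omega>0 S zc zt :: real
  assumes "0 \<le> \<theta>" "\<theta> \<le> 1/60" "0 \<le> \<omega>0" "0 \<le> S" "0 \<le> zc"
    and "S \<le> zc + 3 * (\<theta> * (5 * S + \<omega>0))" and "zc \<le> zt + 3 * (\<theta> * (5 * S + \<omega>0))"
  shows "\<theta> * (5 * S + \<omega>0) \<le> \<theta> * (10 * zt + 2 * \<omega>0)"
proof -
  have f1: "\<theta> * S \<le> S / 60" "\<theta> * zc \<le> zc / 60" "\<theta> * (\<theta> * \<omega>0) \<le> \<theta> * \<omega>0 / 60"
    using mult_right_mono[OF assms(2)] assms by auto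
  have "S \<le> 4/3 * zc + 4 * (\<theta> * \<omega>0)" using assms(6) f1 by (simp add: algebra_simps)
  from mult_left_mono[OF this assms(1)]
  have f2: "\<theta> * S \<le> 4/3 * (\<theta> * zc) + 4 * (\<theta> * (\<theta> * \<omega>0))" by (simp add: algebra_simps)
  have "zc \<le> 3/2 * zt + 6 * (\<theta> * \<omega>0)" using assms(7) f1 f2 by (simp add: algebra_simps)
  from mult_left_mono[OF this assms(1)]
  have "\<theta> * zc \<le> 3/2 * (\<theta> * zt) + 6 * (\<theta> * (\<theta> * \<omega>0))" by (simp add: algebra_simps)
  then show ?thesis using f1 f2 by (simp add: algebra_simps)
qed

text \<open>While the trigger is disabled, \<open>|z|\<close> changes by at most a factor close to one over a
  window of length \<open>\<tau>\<close>; this bounds the growth of the sampling error by \<open>|z|\<close> at the end of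
  the window.\<close>
lemma sampling_error_during_dwell:
  fixes x xh xs F G :: "real \<Rightarrow> real^'n"
  assumes ct: "c \<le> t" "t \<le> c + \<tau>"
    and M0: "M \<ge> 0" and th: "\<theta> = \<tau> * M" "\<theta> \<le> 1/60" and tau0: "\<tau> \<ge> 0" and w0: "\<omega>0 \<ge> 0"
    and intF: "\<And>r. r \<in> {c..t} \<Longrightarrow> (F has_integral (x r - x c)) {c..r}"
    and intG: "\<And>r. r \<in> {c..t} \<Longrightarrow> (G has_integral (xh r - xh c)) {c..r}"
    and bF: "\<And>r. r \<in> {c..t} \<Longrightarrow> norm (F r) \<le> M * (norm (x r) + norm (xh r) + norm (xs r) + \<omega>0)"
    and bG: "\<And>r. r \<in> {c..t} \<Longrightarrow> norm (G r) \<le> M * (norm (x r) + norm (xh r) + norm (xs r) + \<omega>0)"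
    and xs: "\<And>r. r \<in> {c..t} \<Longrightarrow> xs r = xh c"
    and cont: "continuous_on {c..t} (\<lambda>r. norm (stack (x r) (x r - xh r)))"
  shows "norm (xh c - xh t) \<le> \<theta> * (10 * norm (stack (x t) (x t - xh t)) + 2 * \<omega>0)"
proof -
  define nz where "nz r = norm (stack (x r) (x r - xh r))" for r
  obtain r0 where r0: "r0 \<in> {c..t}" "\<And>r. r \<in> {c..t} \<Longrightarrow> nz r \<le> nz r0"
    using continuous_attains_sup[OF compact_Icc _ cont] ct unfolding nz_def by auto
  define S where "S = nz r0"
  define Q where "Q = \<theta> * (5 * S + \<omega>0)"
  have cin: "c \<in> {c..t}" and tin: "t \<in> {c..t}" using ct by auto
  define Bd where "Bd = M * (5 * S + \<omega>0)"
  have "M * (norm (x r) + norm (xh r) + norm (xs r) + \<omega>0) \<le> Bd" if r: "r \<in> {c..t}" for r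
  proof -
    have "norm (x r) \<le> nz r" unfolding nz_def by (rule norm_le_norm_stack1)
    moreover have "norm (xh r) \<le> 2 * nz r" unfolding nz_def by (rule norm_le_twice_norm_stack_diff)
    moreover have "norm (xs r) \<le> 2 * nz c"
      unfolding nz_def using xs[OF r] by (simp add: norm_le_twice_norm_stack_diff)
    ultimately show ?thesis
      using r0(2)[OF r] r0(2)[OF cin] M0 unfolding Bd_def S_def by (intro mult_left_mono) auto
  qed
  then have bFG: "norm (F r) \<le> Bd" "norm (G r) \<le> Bd" if "r \<in> {c..t}" for r
    using bF[OF that] bG[OF that] that by fastforce+
  have BdQ: "Bd * (r - c) \<le> Q" if r: "r \<in> {c..t}" for r
  proof -
    have "0 \<le> Bd" using M0 w0 by (simp add: Bd_def S_def nz_def)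
    then have "Bd * (r - c) \<le> Bd * \<tau>" using r ct by (intro mult_left_mono) auto
    then show ?thesis by (simp add: Bd_def Q_def th algebra_simps)
  qed
  have dx: "norm (x r - x c) \<le> Q" if r: "r \<in> {c..t}" for r
  proof -
    have "norm (x r - x c) \<le> Bd * (r - c)" by (rule norm_increment_le[OF intF[OF r]]) (use r bFG in auto)
    then show ?thesis using BdQ[OF r] by simp
  qed
  have dxh: "norm (xh r - xh c) \<le> Q" if r: "r \<in> {c..t}" for r
  proof -
    have "norm (xh r - xh c) \<le> Bd * (r - c)" by (rule norm_increment_le[OF intG[OF r]]) (use r bFG in auto)
    then show ?thesis using BdQ[OF r] by simp
  qed
  have "S \<le> nz c + 3 * Q"
    using norm_stack_diff_le[of "x r0" "xh r0" "x c" "xh c"] dx[OF r0(1)] dxh[OF r0(1)]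
    unfolding nz_def S_def by linarith
  moreover have "nz c \<le> nz t + 3 * Q"
    using norm_stack_diff_le[of "x c" "xh c" "x t" "xh t"] dx[OF tin] dxh[OF tin]
    unfolding nz_def by (simp add: norm_minus_commute)
  ultimately have "Q \<le> \<theta> * (10 * nz t + 2 * \<omega>0)"
    unfolding Q_def using th tau0 M0 w0 by (intro dwell_window_arith) (auto simp: S_def nz_def)
  then show ?thesis using dxh[OF tin] by (simp add: nz_def norm_minus_commute)
qed

lemma sqrt_exp_half: "sqrt (exp y) = exp (y / 2)"
proof -
  have "exp y = (exp (y / 2))\<^sup>2" by (simp add: power2_eq_square flip: exp_add)
  then show ?thesis by simp
qed

lemma mult_le_weighted_squares:
  fixes q b n :: real
  assumes "q > 0"
  shows "b * n \<le> q / 4 * n\<^sup>2 + b\<^sup>2 / q"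
proof -
  have "q / 4 * n\<^sup>2 + b\<^sup>2 / q - b * n = (q * n / 2 - b)\<^sup>2 / q"
    using assms by (simp add: field_simps power2_eq_square)
  moreover have "(q * n / 2 - b)\<^sup>2 / q \<ge> 0" using assms by simp
  ultimately show ?thesis by linarith
qed

lemma sup_norm_nonneg: "admissible_dist \<omega>0 w \<Longrightarrow> sup_norm w \<ge> 0"
proof -
  assume "admissible_dist \<omega>0 w"
  then have "bdd_above ((\<lambda>r. norm (w r)) ` {0..})"
    unfolding admissible_dist_def by (intro bdd_aboveI[of _ \<omega>0]) auto
  then have "norm (w 0) \<le> sup_norm w" unfolding sup_norm_def by (intro cSUP_upper) auto
  then show ?thesis by (meson norm_ge_zero order_trans)
qed

text \<open>A solution of the event-triggered loop with \<open>\<sigma> = \<theta>\<close> and \<open>\<epsilon> = \<omega>0\<close>, where the same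
  \<open>\<theta>\<close> also bounds the growth of the state during the dwell time \<open>\<tau>\<close>.\<close>
locale et_closed_loop = plant_bounds +
  fixes P and \<alpha>0 \<mu> \<omega>0 KP c1 \<theta> \<tau> :: real and w x xh xs and tk :: "nat \<Rightarrow> ereal"
  assumes lyap: "cl_lyap A B C D E Ew Fw Cq p K1 K2 L1 L2 P \<alpha>0 \<mu> \<omega>0"
    and P_bound: "\<And>v. norm (P *v v) \<le> KP * norm v" and KP_ge_1: "KP \<ge> 1"
    and P_coercive: "\<And>v. c1 * (norm v)\<^sup>2 \<le> v \<bullet> (P *v v)" and c1_pos: "c1 > 0"
    and \<omega>0_pos: "\<omega>0 > 0" and \<alpha>0_pos: "\<alpha>0 > 0" and \<mu>_pos: "\<mu> > 0"
    and \<theta>_pos: "\<theta> > 0" and \<theta>_le: "\<theta> \<le> 1/60"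
    and \<theta>_gain: "10 * \<theta> * (KP * vf_bound) \<le> \<alpha>0 * c1 / 4"
    and dwell_time: "\<theta> = \<tau> * vf_bound"
    and admissible: "admissible_dist \<omega>0 w"
    and solution: "et_solution A B C D E Ew Fw Cq p K1 K2 L1 L2 \<tau> \<theta> \<omega>0 w x xh xs tk"
begin

definition z where "z r = stack (x r) (x r - xh r)"
definition V where "V r = z r \<bullet> (P *v z r)"
definition dx where "dx r = plant_field (x r) (xs r) (w r)"
definition dxh where "dxh r = obs_field (x r) (xh r) (xs r) (w r)"

lemma norm_w_le: "r \<ge> 0 \<Longrightarrow> norm (w r) \<le> \<omega>0"
  using admissible unfolding admissible_dist_def by blast

lemma tau_pos: "\<tau> > 0"
  using \<theta>_pos vf_bound_ge_1 dwell_time by (simp add: zero_less_mult_iff)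

lemma x_increment: "0 \<le> a \<Longrightarrow> a \<le> b \<Longrightarrow> (dx has_integral (x b - x a)) {a..b}"
  using solution unfolding et_solution_def dx_def plant_field_def
  by (intro has_integral_increment_subinterval) auto

lemma xh_increment: "0 \<le> a \<Longrightarrow> a \<le> b \<Longrightarrow> (dxh has_integral (xh b - xh a)) {a..b}"
  using solution unfolding et_solution_def dxh_def obs_field_def
  by (intro has_integral_increment_subinterval) auto

lemma z_increment: "0 \<le> a \<Longrightarrow> a \<le> b \<Longrightarrow>
    ((\<lambda>r. stack (dx r) (dx r - dxh r)) has_integral (z b - z a)) {a..b}"
  using has_integral_stack[OF x_increment has_integral_diff[OF x_increment xh_increment]]
  by (simp add: z_def stack_diff[symmetric] algebra_simps)

lemma continuous_on_z: "continuous_on {0..T} z"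
proof -
  have "continuous_on {0..T} x" "continuous_on {0..T} xh"
    using solution unfolding et_solution_def by (auto intro: continuous_on_if_integral_form)
  then show ?thesis unfolding z_def by (intro continuous_on_stack continuous_on_diff)
qed

lemma continuous_on_V: "continuous_on {0..T} V"
  unfolding V_def
  by (intro continuous_on_inner continuous_on_z
      bounded_linear.continuous_on[OF matrix_vector_mul_bounded_linear])

lemma sampling_error_le:
  assumes r0: "r \<ge> 0"
  shows "norm (xs r - xh r) \<le> 10 * \<theta> * norm (z r) + \<omega>0"
proof -
  have tk0: "tk 0 = 0"
    and trig: "\<forall>k. tk k < \<infinity> \<longrightarrow> tk (Suc k) = Inf (ereal ` {t. tk k + ereal \<tau> \<le> ereal t \<and>
                   norm (xh (real_of_ereal (tk k)) - xh t) > \<theta> * norm (xh t) + \<omega>0})"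
    and inf: "\<forall>k. tk k = \<infinity> \<longrightarrow> tk (Suc k) = \<infinity>"
    and hold: "\<forall>k t. tk k \<le> ereal t \<and> ereal t < tk (Suc k) \<longrightarrow> xs t = xh (real_of_ereal (tk k))"
    using solution unfolding et_solution_def by auto
  obtain k c where kc: "tk k = ereal c" "0 \<le> c" "c \<le> r" "ereal r < tk (Suc k)"
    and no_event: "c + \<tau> \<le> r \<Longrightarrow> \<not> norm (xh (real_of_ereal (tk k)) - xh r) > \<theta> * norm (xh r) + \<omega>0"
    using event_interval_around[OF tk0 trig inf tau_pos r0] by blast
  have held: "xs r' = xh c" if "r' \<in> {c..r}" for r'
  proof -
    have "ereal r' < tk (Suc k)" using kc(4) that by (meson atLeastAtMost_iff ereal_less_eq(3) order_le_less_trans)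
    moreover have "tk k \<le> ereal r'" using kc(1) that by simp
    ultimately show ?thesis using hold kc(1) by fastforce
  qed
  have norm_xh: "norm (xh r) \<le> 2 * norm (z r)"
    unfolding z_def by (rule norm_le_twice_norm_stack_diff)
  show ?thesis
  proof (cases "c + \<tau> \<le> r")
    case True
    then have "norm (xh c - xh r) \<le> \<theta> * norm (xh r) + \<omega>0" using no_event kc(1) by simp
    also have "\<theta> * norm (xh r) \<le> 2 * \<theta> * norm (z r)" using norm_xh \<theta>_pos by simp
    finally have "norm (xh c - xh r) \<le> 2 * (\<theta> * norm (z r)) + \<omega>0" by simp
    moreover have "0 \<le> \<theta> * norm (z r)" using \<theta>_pos by simp
    ultimately show ?thesis using held[of r] kc by simp
  next
    case False
    have "norm (xh c - xh r) \<le> \<theta> * (10 * norm (z r) + 2 * \<omega>0)"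
      unfolding z_def
    proof (rule sampling_error_during_dwell[where M=vf_bound and F=dx and G=dxh and xs=xs])
      show "c \<le> r" "r \<le> c + \<tau>" using kc False by auto
      show "0 \<le> vf_bound" "\<theta> = \<tau> * vf_bound" "\<theta> \<le> 1/60" "\<tau> \<ge> 0" "\<omega>0 \<ge> 0"
        using vf_bound_ge_1 dwell_time \<theta>_le tau_pos \<omega>0_pos by auto
      show "(dx has_integral (x r' - x c)) {c..r'}" "(dxh has_integral (xh r' - xh c)) {c..r'}"
        if "r' \<in> {c..r}" for r'
        using x_increment xh_increment that kc(2) by auto
      show "norm (dx r') \<le> vf_bound * (norm (x r') + norm (xh r') + norm (xs r') + \<omega>0)"
        "norm (dxh r') \<le> vf_bound * (norm (x r') + norm (xh r') + norm (xs r') + \<omega>0)"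
        if "r' \<in> {c..r}" for r'
        unfolding dx_def dxh_def using norm_w_le[of r'] that kc(2)
        by (auto intro: norm_plant_field_le_bound norm_obs_field_le_bound)
      show "xs r' = xh c" if "r' \<in> {c..r}" for r' using held that .
      show "continuous_on {c..r} (\<lambda>r. norm (stack (x r) (x r - xh r)))"
        using continuous_on_subset[OF continuous_on_z[of r]] kc(2)
        unfolding z_def by (intro continuous_on_norm) auto
    qed
    moreover have "2 * (\<theta> * \<omega>0) \<le> \<omega>0" using mult_right_mono[OF \<theta>_le, of \<omega>0] \<omega>0_pos by simp
    ultimately show ?thesis using held[of r] kc by (simp add: algebra_simps)
  qed
qed

definition lyap_offset where
  "lyap_offset = \<mu> * \<omega>0\<^sup>2 + (KP * vf_bound)\<^sup>2 * \<omega>0\<^sup>2 / (\<alpha>0 * c1)"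

lemma lyap_offset_nonneg: "lyap_offset \<ge> 0"
  using \<mu>_pos \<alpha>0_pos c1_pos by (simp add: lyap_offset_def)

text \<open>The relative part \<open>10 \<theta> |z|\<close> of the sampling error costs a quarter of the decay
  rate, the absolute part \<open>\<omega>0\<close> another quarter plus a constant (by AM-GM).\<close>
lemma lyap_derivative_le:
  assumes r0: "r \<ge> 0"
  shows "stack (dx r) (dx r - dxh r) \<bullet> (P *v z r) + z r \<bullet> (P *v stack (dx r) (dx r - dxh r))
    \<le> - (\<alpha>0 / 2) * V r + lyap_offset"
proof -
  define k0 where "k0 = KP * vf_bound"
  define n where "n = norm (z r)"
  define e where "e = norm (xs r - xh r)"
  have k0: "k0 > 0" using KP_ge_1 vf_bound_ge_1 by (simp add: k0_def)
  have n0: "n \<ge> 0" by (simp add: n_def)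
  have "stack (dx r) (dx r - dxh r) \<bullet> (P *v z r) + z r \<bullet> (P *v stack (dx r) (dx r - dxh r))
      \<le> - \<alpha>0 * V r + \<mu> * (norm (w r))\<^sup>2 + k0 * e * n"
    using lyap_derivative_sampled_le[OF lyap P_bound _ norm_w_le[OF r0], of "x r" "xs r" "xh r"] KP_ge_1
    unfolding dx_def dxh_def z_def V_def n_def e_def k0_def by simp
  moreover have "k0 * e * n \<le> (10 * \<theta> * k0) * n\<^sup>2 + (k0 * \<omega>0) * n"
  proof -
    have "k0 * e * n \<le> k0 * (10 * \<theta> * n + \<omega>0) * n"
      using sampling_error_le[OF r0] k0 n0 by (intro mult_right_mono mult_left_mono) (auto simp: e_def n_def)
    then show ?thesis by (simp add: algebra_simps power2_eq_square)
  qed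
  moreover have "(10 * \<theta> * k0) * n\<^sup>2 \<le> (\<alpha>0 * c1 / 4) * n\<^sup>2"
    using \<theta>_gain by (intro mult_right_mono) (auto simp: k0_def)
  moreover have "(k0 * \<omega>0) * n \<le> (\<alpha>0 * c1) / 4 * n\<^sup>2 + (k0 * \<omega>0)\<^sup>2 / (\<alpha>0 * c1)"
    by (rule mult_le_weighted_squares) (use \<alpha>0_pos c1_pos in simp)
  moreover have "\<mu> * (norm (w r))\<^sup>2 \<le> \<mu> * \<omega>0\<^sup>2"
    using norm_w_le[OF r0] \<mu>_pos by (intro mult_left_mono power_mono) auto
  moreover have "(\<alpha>0 * c1 / 4) * n\<^sup>2 + (\<alpha>0 * c1) / 4 * n\<^sup>2 \<le> \<alpha>0 / 2 * V r"
  proof -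
    have "(\<alpha>0 * c1 / 4) * n\<^sup>2 + (\<alpha>0 * c1) / 4 * n\<^sup>2 = \<alpha>0 / 2 * (c1 * n\<^sup>2)" by (simp add: algebra_simps)
    also have "\<dots> \<le> \<alpha>0 / 2 * V r"
      using P_coercive \<alpha>0_pos by (intro mult_left_mono) (auto simp: V_def n_def)
    finally show ?thesis .
  qed
  moreover have "(k0 * \<omega>0)\<^sup>2 / (\<alpha>0 * c1) = k0\<^sup>2 * \<omega>0\<^sup>2 / (\<alpha>0 * c1)" by (simp add: power_mult_distrib)
  ultimately show ?thesis unfolding lyap_offset_def k0_def by linarith
qed

lemma V_increment_le:
  assumes st: "0 \<le> s" "s \<le> t"
  shows "V t - V s \<le> integral {s..t} (\<lambda>r. - (\<alpha>0 / 2) * V r + lyap_offset)"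
proof -
  obtain r1 where r1: "\<And>r. r \<in> {0..t} \<Longrightarrow> norm (z r) \<le> norm (z r1)"
    using continuous_attains_sup[OF compact_Icc _ continuous_on_norm[OF continuous_on_z[of t]]] st by fastforce
  define M where "M = 3 * vf_bound * (6 * norm (z r1) + 2 * \<omega>0)"
  have bnd: "norm (stack (dx r) (dx r - dxh r)) \<le> M" if r: "r \<in> {s..t}" for r
  proof -
    have r0: "r \<ge> 0" and rin: "r \<in> {0..t}" using r st by auto
    have "norm (stack (dx r) (dx r - dxh r)) \<le> 2 * norm (dx r) + norm (dxh r)"
      using norm_stack_le[of "dx r" "dx r - dxh r"] norm_triangle_ineq4[of "dx r" "dxh r"] by simp
    moreover have "norm (x r) + norm (xh r) + norm (xs r) + \<omega>0 \<le> 6 * norm (z r1) + 2 * \<omega>0"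
    proof -
      have "norm (x r) \<le> norm (z r)" unfolding z_def by (rule norm_le_norm_stack1)
      moreover have "norm (xh r) \<le> 2 * norm (z r)" unfolding z_def by (rule norm_le_twice_norm_stack_diff)
      moreover have "norm (xs r) \<le> norm (xh r) + norm (xs r - xh r)"
        using norm_triangle_ineq[of "xh r" "xs r - xh r"] by simp
      moreover have "10 * \<theta> * norm (z r) \<le> norm (z r)"
        using mult_right_mono[OF \<theta>_le norm_ge_zero[of "z r"]] norm_ge_zero[of "z r"]
        by linarith
      ultimately show ?thesis using sampling_error_le[OF r0] r1[OF rin] by linarith
    qed
    then have "norm (dx r) \<le> vf_bound * (6 * norm (z r1) + 2 * \<omega>0)"
      and "norm (dxh r) \<le> vf_bound * (6 * norm (z r1) + 2 * \<omega>0)"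
      using norm_plant_field_le_bound[OF norm_w_le[OF r0]] norm_obs_field_le_bound[OF norm_w_le[OF r0]]
        vf_bound_ge_1 unfolding dx_def dxh_def by (meson mult_left_mono order_trans zero_le_one)+
    ultimately show ?thesis by (simp add: M_def)
  qed
  have "z t \<bullet> (P *v z t) - z s \<bullet> (P *v z s) \<le> integral {s..t} (\<lambda>r. - (\<alpha>0 / 2) * V r + lyap_offset)"
  proof (rule quadratic_form_increment_le_integral[OF st(2) _ bnd _ P_bound])
    show "((\<lambda>r. stack (dx r) (dx r - dxh r)) has_integral (z b - z a)) {a..b}"
      if "s \<le> a" "a \<le> b" "b \<le> t" for a b using z_increment that st by simp
    show "continuous_on {s..t} (\<lambda>r. - (\<alpha>0 / 2) * V r + lyap_offset)"
      by (intro continuous_intros continuous_on_subset[OF continuous_on_V[of t]]) (use st in auto)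
    show "stack (dx r) (dx r - dxh r) \<bullet> (P *v z r) + z r \<bullet> (P *v stack (dx r) (dx r - dxh r))
        \<le> - (\<alpha>0 / 2) * V r + lyap_offset" if "r \<in> {s..t}" for r
      using lyap_derivative_le that st by simp
  qed (use KP_ge_1 in auto)
  then show ?thesis by (simp add: V_def)
qed

lemma V_le: "t \<ge> 0 \<Longrightarrow> V t \<le> exp (- (\<alpha>0 / 2) * t) * V 0 + lyap_offset / (\<alpha>0 / 2)"
  by (rule linear_comparison) (use \<alpha>0_pos lyap_offset_nonneg continuous_on_V V_increment_le in auto)

lemma norm_z_le:
  assumes t0: "t \<ge> 0"
  shows "norm (z t) \<le> sqrt (KP / c1) * norm (z 0) * exp (- (\<alpha>0 / 4 * t))
    + sqrt (2 * lyap_offset / (\<alpha>0 * c1))"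
proof -
  define X where "X = (KP / c1) * exp (- (\<alpha>0 / 2) * t) * (norm (z 0))\<^sup>2"
  define Y where "Y = 2 * lyap_offset / (\<alpha>0 * c1)"
  have "V 0 \<le> KP * (norm (z 0))\<^sup>2"
    using abs_inner_matrix_le[OF P_bound, of "z 0" "z 0"] by (simp add: V_def power2_eq_square)
  then have "c1 * (norm (z t))\<^sup>2 \<le> exp (- (\<alpha>0 / 2) * t) * (KP * (norm (z 0))\<^sup>2) + lyap_offset / (\<alpha>0 / 2)"
    using P_coercive[of "z t"] V_le[OF t0] mult_left_mono[of "V 0" _ "exp (- (\<alpha>0 / 2) * t)"]
    unfolding V_def by (smt (verit) exp_ge_zero)
  then have "(norm (z t))\<^sup>2 \<le> X + Y" using c1_pos \<alpha>0_pos by (simp add: X_def Y_def field_simps)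
  then have "norm (z t) \<le> sqrt (X + Y)" by (simp add: real_le_rsqrt)
  also have "\<dots> \<le> sqrt X + sqrt Y"
    using KP_ge_1 c1_pos lyap_offset_nonneg \<alpha>0_pos by (intro sqrt_add_le_add_sqrt) (auto simp: X_def Y_def)
  also have "sqrt X = sqrt (KP / c1) * norm (z 0) * exp (- (\<alpha>0 / 4 * t))"
  proof -
    have "sqrt X = sqrt (KP / c1) * sqrt (exp (- (\<alpha>0 / 2) * t)) * sqrt ((norm (z 0))\<^sup>2)"
      unfolding X_def real_sqrt_mult by simp
    then show ?thesis by (simp add: sqrt_exp_half)
  qed
  finally show ?thesis by (simp add: Y_def)
qed

end

context plant_bounds
begin

lemma ISpS_et_if_trigger_small:
  assumes "cl_lyap A B C D E Ew Fw Cq p K1 K2 L1 L2 P \<alpha>0 \<mu> \<omega>0"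
    and "\<And>v. norm (P *v v) \<le> KP * norm v" and KP_ge_1: "KP \<ge> 1"
    and "\<And>v. c1 * (norm v)\<^sup>2 \<le> v \<bullet> (P *v v)" and c1_pos: "c1 > 0"
    and "\<omega>0 > 0" and \<alpha>0_pos: "\<alpha>0 > 0" and \<mu>_pos: "\<mu> > 0"
    and "\<theta> > 0" and "\<theta> \<le> 1/60" and "10 * \<theta> * (KP * vf_bound) \<le> \<alpha>0 * c1 / 4"
    and "\<theta> = \<tau> * vf_bound"
  shows "ISpS_et A B C D E Ew Fw Cq p K1 K2 L1 L2 \<tau> \<theta> \<omega>0 \<omega>0"
proof -
  define offset where
    "offset = sqrt (2 * (\<mu> * \<omega>0\<^sup>2 + (KP * vf_bound)\<^sup>2 * \<omega>0\<^sup>2 / (\<alpha>0 * c1)) / (\<alpha>0 * c1))"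
  have "norm (stack (x t) (x t - xh t))
      \<le> sqrt (KP / c1) * norm (stack (x 0) (x 0 - xh 0)) * exp (- (\<alpha>0 / 4 * t)) + sup_norm w + offset"
    if adm: "admissible_dist \<omega>0 w" and sol: "et_solution A B C D E Ew Fw Cq p K1 K2 L1 L2 \<tau> \<theta> \<omega>0 w x xh xs tk"
      and t0: "t \<ge> 0"
    for w :: "real \<Rightarrow> real^'nw" and x xh xs :: "real \<Rightarrow> real^'nx" and tk t
  proof -
    interpret et_closed_loop A B C D E Ew Fw Cq p K1 K2 L1 L2 N P \<alpha>0 \<mu> \<omega>0 KP c1 \<theta> \<tau> w x xh xs tk
      by unfold_locales (fact assms that)+
    show ?thesis
      using norm_z_le[OF t0] sup_norm_nonneg[OF adm] by (simp add: z_def offset_def lyap_offset_def)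
  qed
  moreover have "class_KL (\<lambda>s t. sqrt (KP / c1) * s * exp (- (\<alpha>0 / 4 * t)))"
    using KP_ge_1 c1_pos \<alpha>0_pos by (intro class_KL_exp_decay) auto
  moreover have "offset \<ge> 0" using \<mu>_pos \<alpha>0_pos c1_pos by (simp add: offset_def)
  ultimately show ?thesis
    unfolding ISpS_et_def using class_K_id by blast
qed

end

lemma onorm_matrix_vector_nonneg: "0 \<le> onorm ((*v) (M :: real^'n^'m))"
  by (rule onorm_pos_le[OF matrix_vector_mul_bounded_linear])

lemma matrix_vector_norm_le:
  fixes M :: "real^'n^'m"
  assumes "onorm ((*v) M) \<le> K"
  shows "norm (M *v v) \<le> K * norm v"
  using onorm[OF matrix_vector_mul_bounded_linear, of M v] mult_right_mono[OF assms norm_ge_zero[of v]]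
  by linarith

text \<open>The locale predicate omits \<open>D\<close>, which occurs in none of its assumptions.\<close>
lemma plant_bounds_exist:
  assumes "Lp-lipschitz_on UNIV p" and "p 0 = 0"
  obtains N where "plant_bounds A B C E Ew Fw Cq p K1 K2 L1 L2 N"
proof
  define N where "N = 1 + Lp + onorm ((*v) A) + onorm ((*v) B) + onorm ((*v) C) + onorm ((*v) E)
    + onorm ((*v) Ew) + onorm ((*v) Fw) + onorm ((*v) Cq) + onorm ((*v) K1) + onorm ((*v) K2)
    + onorm ((*v) L1) + onorm ((*v) L2)"
  have Lp: "Lp \<ge> 0" using assms(1) by (rule lipschitz_on_nonneg)
  note onorms = onorm_matrix_vector_nonneg[of A] onorm_matrix_vector_nonneg[of B]
    onorm_matrix_vector_nonneg[of C] onorm_matrix_vector_nonneg[of E] onorm_matrix_vector_nonneg[of Ew]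
    onorm_matrix_vector_nonneg[of Fw] onorm_matrix_vector_nonneg[of Cq] onorm_matrix_vector_nonneg[of K1]
    onorm_matrix_vector_nonneg[of K2] onorm_matrix_vector_nonneg[of L1] onorm_matrix_vector_nonneg[of L2]
  have "norm (p a - p b) \<le> N * norm (a - b)" for a b
  proof -
    have "norm (p a - p b) \<le> Lp * norm (a - b)"
      using lipschitz_onD[OF assms(1), of a b] by (simp add: dist_norm)
    also have "\<dots> \<le> N * norm (a - b)" using Lp onorms by (intro mult_right_mono) (auto simp: N_def)
    finally show ?thesis .
  qed
  then show "plant_bounds A B C E Ew Fw Cq p K1 K2 L1 L2 N"
    using assms(2) Lp onorms by unfold_locales (auto simp: N_def intro!: matrix_vector_norm_le)
qed

theorem theorem3:
  fixes A :: "real^'nx^'nx" and B :: "real^'nu^'nx" and C :: "real^'nx^'ny"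
    and D :: "real^'nu^'ny" and E :: "real^'np^'nx" and Ew :: "real^'nw^'nx"
    and Fw :: "real^'nw^'ny" and Cq :: "real^'nx^'nq" and p :: "real^'nq \<Rightarrow> real^'np"
    and K1 :: "real^'nx^'nu" and K2 :: "real^'np^'nu"
    and L1 :: "real^'ny^'nq" and L2 :: "real^'ny^'nx"
    and P :: "real^('nx + 'nx)^('nx + 'nx)"
    and \<omega>0 \<alpha>0 \<mu> :: real
  assumes p_lip: "\<exists>L. L-lipschitz_on UNIV p"
    and p0: "p 0 = 0"
    and \<omega>0_pos: "\<omega>0 > 0"
    and \<alpha>0_pos: "\<alpha>0 > 0"
    and \<mu>_pos: "\<mu> > 0"
    and P_sym: "transpose P = P"
    and P_pos: "\<forall>z. z \<noteq> 0 \<longrightarrow> z \<bullet> (P *v z) > 0"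
    and lyap: "cl_lyap A B C D E Ew Fw Cq p K1 K2 L1 L2 P \<alpha>0 \<mu> \<omega>0"
  shows "\<exists>\<tau> \<sigma> \<epsilon>. \<tau> > 0 \<and> \<sigma> > 0 \<and> \<epsilon> > 0 \<and>
           ISpS_et A B C D E Ew Fw Cq p K1 K2 L1 L2 \<tau> \<sigma> \<epsilon> \<omega>0"
proof -
  obtain Lp where "Lp-lipschitz_on UNIV p" using p_lip by blast
  then obtain N where "plant_bounds A B C E Ew Fw Cq p K1 K2 L1 L2 N"
    using p0 by (rule plant_bounds_exist)
  then interpret plant_bounds A B C D E Ew Fw Cq p K1 K2 L1 L2 N .
  define KP where "KP = 1 + onorm ((*v) P)"
  have KP: "KP \<ge> 1" "\<And>v. norm (P *v v) \<le> KP * norm v"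
    using onorm_matrix_vector_nonneg[of P] by (auto simp: KP_def intro: matrix_vector_norm_le)
  obtain c1 where c1: "c1 > 0" "\<And>v. c1 * (norm v)\<^sup>2 \<le> v \<bullet> (P *v v)"
    using pos_def_quadratic_lower_bound[OF P_pos] by blast
  define \<theta> where "\<theta> = min (1/60) (\<alpha>0 * c1 / (40 * (KP * vf_bound)))"
  define \<tau> where "\<tau> = \<theta> / vf_bound"
  have "KP * vf_bound > 0" using KP vf_bound_ge_1 by simp
  then have \<theta>: "\<theta> > 0" "\<theta> \<le> 1/60" "10 * \<theta> * (KP * vf_bound) \<le> \<alpha>0 * c1 / 4"
    using \<alpha>0_pos c1 by (auto simp: \<theta>_def min_def field_simps)
  moreover have "\<theta> = \<tau> * vf_bound" "\<tau> > 0" using \<theta>(1) vf_bound_ge_1 by (auto simp: \<tau>_def)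
  ultimately have "ISpS_et A B C D E Ew Fw Cq p K1 K2 L1 L2 \<tau> \<theta> \<omega>0 \<omega>0"
    using ISpS_et_if_trigger_small[OF lyap KP(2,1) c1(2,1) \<omega>0_pos \<alpha>0_pos \<mu>_pos] by blast
  then show ?thesis using \<open>\<tau> > 0\<close> \<theta>(1) \<omega>0_pos by blast
qed

end
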